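(* Let $n\ge 2$, let $(X_i,d_i)$ $(i=1,\ldots,n)$ be nonempty metric spaces, let $M:=X_1\times\cdots\times X_n$, and let $\psi\in\mathbf{\Psi}_n$. Then $(X_i,d_i)$ is a length space for every $i=1,\ldots,n$ if and only if $(M,d_\psi)$ is a length space.
   Context: For $n\ge 2$, let $\Omega_n:=\{(t_1,\ldots,t_n)\in\mathbb{R}^n \mid t_i\ge 0,\ \sum_{i=1}^n t_i=1\}$. The class $\mathbf{\Psi}_n$ consists of all continuous convex functions $\psi:\Omega_n\to\mathbb{R}$ such that $\psi(\mathbf{e}_1)=\cdots=\psi(\mathbf{e}_n)=1$, where $\mathbf{e}_1,\ldots,\mathbf{e}_n$ are the standard basis vectors of $\mathbb{R}^n$, and $$\psi(t_1,\ldots,t_n)\ge (1-t_i)\cdot\psi\left(\frac{t_1}{1-t_i},\ldots,\frac{t_{i-1}}{1-t_i},0,\frac{t_{i+1}}{1-t_i},\ldots,\frac{t_n}{1-t_i}\right)$$ for every $i=1,\ldots,n$ and all $(t_1,\ldots,t_n)\in\Omega_n$ with $t_i<1$. For metric spaces $(X_i,d_i)$ and $\psi\in\mathbf{\Psi}_n$, the metric $d_\psi$ on $M=X_1\times\cdots\times X_n$ is defined by $d_\psi(x,y):=0$ if $x=y$ and, for $x=(x_1,\ldots,x_n)\ne y=(y_1,\ldots,y_n)$, with $D:=\sum_{i=1}^n d_i(x_i,y_i)$, $$d_\psi(x,y):=D\cdot\psi\left(\frac{d_1(x_1,y_1)}{D},\ldots,\frac{d_n(x_n,y_n)}{D}\right).$$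 A curve in a metric space $(X,d)$ is a continuous map $\sigma:[a,b]\to X$ with $a\le b$ real; it joins $\sigma(a)$ and $\sigma(b)$. Its length is $L(\sigma):=\sup\sum_{i=1}^{m} d(\sigma(t_{i-1}),\sigma(t_i))$, the supremum being over all partitions $a=t_0<t_1<\cdots<t_m=b$ of $[a,b]$ (the supremum over the empty set is $0$). A curve is rectifiable if $L(\sigma)<\infty$. A metric space $(X,d)$ is a length space if for all $u,v\in X$, $d(u,v)$ equals the infimum of $L(\sigma)$ over all rectifiable curves $\sigma$ joining $u$ and $v$ (the infimum over the empty set is $\infty$). *)

theory Defs
  imports "HOL-Analysis.Analysis"
begin

definition Omega :: "(real ^ 'n::finite) set" where
  "Omega = {t. (\<forall>i. 0 \<le> t $ i) \<and> (\<Sum>i\<in>UNIV. t $ i) = 1}"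

(* Only the restriction of a member to Omega matters: functions in HOL are total. *)
definition Psi :: "(real ^ 'n::finite \<Rightarrow> real) set" where
  "Psi = {\<psi>. continuous_on Omega \<psi> \<and> convex_on Omega \<psi> \<and>
     (\<forall>i. \<psi> (axis i 1) = 1) \<and>
     (\<forall>t\<in>Omega. \<forall>i. t $ i < 1 \<longrightarrow>
        \<psi> t \<ge> (1 - t $ i) * \<psi> (\<chi> j. if j = i then 0 else t $ j / (1 - t $ i)))}"

definition dist_psi ::
  "(real ^ 'n::finite \<Rightarrow> real) \<Rightarrow> ('n \<Rightarrow> 'a \<Rightarrow> 'a \<Rightarrow> real) \<Rightarrow> ('n \<Rightarrow> 'a) \<Rightarrow> ('n \<Rightarrow> 'a) \<Rightarrow> real" where
  "dist_psi \<psi> d x y =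
     (if x = y then 0
      else let D = (\<Sum>i\<in>UNIV. d i (x i) (y i))
           in D * \<psi> (\<chi> i. d i (x i) (y i) / D))"

(* A curve is given by its domain {a..b} and a total function, whose values
   outside {a..b} are irrelevant. *)
definition curve :: "'a set \<Rightarrow> ('a \<Rightarrow> 'a \<Rightarrow> real) \<Rightarrow> real \<Rightarrow> real \<Rightarrow> (real \<Rightarrow> 'a) \<Rightarrow> bool" where
  "curve X d a b \<sigma> \<longleftrightarrow>
     a \<le> b \<and> continuous_map (top_of_set {a..b}) (Metric_space.mtopology X d) \<sigma>"

(* In ennreal, Sup {} = 0 and Inf {} = \<infinity>; the former gives length 0 if a = b. *)
definition curve_length :: "('a \<Rightarrow> 'a \<Rightarrow> real) \<Rightarrow> real \<Rightarrow> real \<Rightarrow> (real \<Rightarrow> 'a) \<Rightarrow> ennreal" where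
  "curve_length d a b \<sigma> =
     Sup {\<Sum>i=1..m. ennreal (d (\<sigma> (t (i - 1))) (\<sigma> (t i))) | (m::nat) (t::nat \<Rightarrow> real).
            1 \<le> m \<and> t 0 = a \<and> t m = b \<and> (\<forall>i\<in>{1..m}. t (i - 1) < t i)}"

definition rectifiable :: "('a \<Rightarrow> 'a \<Rightarrow> real) \<Rightarrow> real \<Rightarrow> real \<Rightarrow> (real \<Rightarrow> 'a) \<Rightarrow> bool" where
  "rectifiable d a b \<sigma> \<longleftrightarrow> curve_length d a b \<sigma> < \<infinity>"

definition length_space :: "'a set \<Rightarrow> ('a \<Rightarrow> 'a \<Rightarrow> real) \<Rightarrow> bool" where
  "length_space X d \<longleftrightarrow> Metric_space X d \<and>
     (\<forall>u\<in>X. \<forall>v\<in>X. ennreal (d u v) =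
        Inf {curve_length d a b \<sigma> | a b \<sigma>.
               curve X d a b \<sigma> \<and> rectifiable d a b \<sigma> \<and> \<sigma> a = u \<and> \<sigma> b = v})"

end

theory Submission
  imports Defs
begin

text \<open>
  Two ideas make the theorem short.

  First, a function \<open>\<psi>\<close> of the class extends from the simplex to a positively homogeneous
  function \<open>N x = S * \<psi> (x / S)\<close> on the nonnegative orthant, where \<open>S\<close> is the sum of the
  coordinates of \<open>x\<close> (\<open>psi_gauge\<close> below), and \<open>dist_psi\<close> is \<open>N\<close> applied to the vector of
  coordinate distances. Convexity of \<open>\<psi>\<close> makes \<open>N\<close> subadditive (\<open>psi_gauge_add_le\<close>). The last
  condition in the definition of the class says that replacing a coordinate by \<open>0\<close> does not
  increase \<open>N\<close>; together with convexity this makes \<open>N\<close> monotone (\<open>psi_gauge_mono\<close>).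
  As \<open>N\<close> is normalised on the axes, it dominates every coordinate.

  Second, a length space is a metric space in which any two points \<open>u\<close>, \<open>v\<close> are joined, for
  every \<open>e > 0\<close>, by a path on the unit interval that is Lipschitz with constant \<open>d u v + e\<close>
  (\<open>length_space_iff_lipschitz_paths\<close>). The nontrivial half reparametrises a rectifiable curve
  proportionally to its arc length.

  In terms of Lipschitz paths both directions are immediate. If the factors are length spaces, run
  paths with constants \<open>d i (u i) (v i) + h\<close> simultaneously: by monotonicity and homogeneity
  the product path has as constant \<open>N\<close> of the vector of these constants, and by
  subadditivity this exceeds \<open>dist_psi \<psi> d u v\<close> by at most \<open>h * N (1, \<dots>, 1)\<close>.
  Conversely, embed a factor in the product by
  fixing all other coordinates. The embedding is isometric by the normalisation of \<open>N\<close>, and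
  since the coordinate projections do not increase distances, they carry the Lipschitz paths of the
  product to Lipschitz paths of the factor.
\<close>

section \<open>The gauge of a convex function on the simplex\<close>

text \<open>
  The positively homogeneous extension of \<open>\<psi>\<close> to the nonnegative orthant; the convention
  \<open>x / 0 = 0\<close> does no harm at the origin because of the factor in front.
\<close>

definition psi_gauge :: "(real ^ 'n::finite \<Rightarrow> real) \<Rightarrow> real ^ 'n \<Rightarrow> real" where
  "psi_gauge \<psi> x = (\<Sum>i\<in>UNIV. x $ i) * \<psi> (\<chi> i. x $ i / (\<Sum>j\<in>UNIV. x $ j))"

lemma sum_nonneg_vec:
  fixes x :: "real ^ 'n::finite"
  assumes "\<And>i. 0 \<le> x $ i"
  shows "0 \<le> (\<Sum>i\<in>UNIV. x $ i)"
  using assms by (simp add: sum_nonneg)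

lemma nonneg_vec_eq_0_if_sum_eq_0:
  fixes x :: "real ^ 'n::finite"
  assumes "\<And>i. 0 \<le> x $ i" "(\<Sum>i\<in>UNIV. x $ i) = 0"
  shows "x = 0"
  using assms by (simp add: vec_eq_iff sum_nonneg_eq_0_iff)

lemma normalised_in_Omega:
  fixes x :: "real ^ 'n::finite"
  assumes "\<And>i. 0 \<le> x $ i" "(\<Sum>i\<in>UNIV. x $ i) \<noteq> 0"
  shows "(\<chi> i. x $ i / (\<Sum>j\<in>UNIV. x $ j)) \<in> Omega"
  using assms sum_nonneg_vec[of x]
  by (auto simp: Omega_def simp flip: sum_divide_distrib)

lemma psi_gauge_0 [simp]: "psi_gauge \<psi> 0 = 0"
  by (simp add: psi_gauge_def)

lemma psi_gauge_scaleR: "psi_gauge \<psi> (c *\<^sub>R x) = c * psi_gauge \<psi> x"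
proof (cases "c = 0")
  case False
  then show ?thesis
    by (simp add: psi_gauge_def flip: sum_distrib_left)
qed simp

lemma psi_gauge_axis:
  assumes "\<psi> \<in> Psi"
  shows "psi_gauge \<psi> (axis i c) = c"
proof -
  have "psi_gauge \<psi> (axis i 1) = 1"
  proof -
    have "(\<Sum>j\<in>UNIV. axis i (1::real) $ j) = 1"
      by (simp add: axis_def)
    then show ?thesis
      using assms by (simp add: psi_gauge_def Psi_def)
  qed
  moreover have "axis i c = c *\<^sub>R axis i (1::real)"
    by (simp add: vec_eq_iff axis_def)
  ultimately show ?thesis
    by (simp add: psi_gauge_scaleR)
qed

text \<open>
  Subadditivity is convexity of \<open>\<psi>\<close> in homogeneous form: the normalisation of \<open>x + y\<close> is the
  convex combination of the normalisations of \<open>x\<close> and \<open>y\<close> with weights proportional to their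
  coordinate sums.
\<close>

lemma psi_gauge_add_le:
  fixes x y :: "real ^ 'n::finite"
  assumes "\<psi> \<in> Psi" and x: "\<And>i. 0 \<le> x $ i" and y: "\<And>i. 0 \<le> y $ i"
  shows "psi_gauge \<psi> (x + y) \<le> psi_gauge \<psi> x + psi_gauge \<psi> y"
proof -
  define S T where "S = (\<Sum>i\<in>UNIV. x $ i)" and "T = (\<Sum>i\<in>UNIV. y $ i)"
  have ST: "0 \<le> S" "0 \<le> T" "(\<Sum>i\<in>UNIV. (x + y) $ i) = S + T"
    using sum_nonneg_vec[of x] sum_nonneg_vec[of y] x y
    by (auto simp: S_def T_def sum.distrib)
  consider "S = 0" | "T = 0" | "0 < S" "0 < T"
    using ST by linarith
  then show ?thesis
  proof cases
    case 1
    then have "x = 0"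
      using x by (intro nonneg_vec_eq_0_if_sum_eq_0) (auto simp: S_def)
    then show ?thesis by simp
  next
    case 2
    then have "y = 0"
      using y by (intro nonneg_vec_eq_0_if_sum_eq_0) (auto simp: T_def)
    then show ?thesis by simp
  next
    case 3
    define p q where "p = (\<chi> i. x $ i / S)" and "q = (\<chi> i. y $ i / T)"
    have pq: "p \<in> Omega" "q \<in> Omega"
      using normalised_in_Omega[of x] normalised_in_Omega[of y] x y 3
      by (auto simp: p_def q_def S_def T_def)
    have eq: "1 - T / (S + T) = S / (S + T)"
      using 3 by (simp add: field_simps)
    have *: "\<psi> ((S / (S + T)) *\<^sub>R p + (T / (S + T)) *\<^sub>R q)
      \<le> S / (S + T) * \<psi> p + T / (S + T) * \<psi> q"
    proof -
      have "convex_on Omega \<psi>"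
        using assms(1) by (simp add: Psi_def)
      then show ?thesis
        using convex_onD[of Omega \<psi> "T / (S + T)" p q] pq 3 unfolding eq by simp
    qed
    have "(\<chi> i. (x + y) $ i / (S + T)) = (S / (S + T)) *\<^sub>R p + (T / (S + T)) *\<^sub>R q"
      using 3 by (simp add: vec_eq_iff p_def q_def add_divide_distrib)
    then have "psi_gauge \<psi> (x + y) = (S + T) * \<psi> ((S / (S + T)) *\<^sub>R p + (T / (S + T)) *\<^sub>R q)"
      by (simp only: psi_gauge_def ST(3))
    also have "\<dots> \<le> (S + T) * (S / (S + T) * \<psi> p + T / (S + T) * \<psi> q)"
      using * 3 by (intro mult_left_mono) auto
    also have "\<dots> = S * \<psi> p + T * \<psi> q"
      using 3 by (simp add: distrib_left)
    finally show ?thesis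
      by (simp add: psi_gauge_def p_def q_def S_def T_def)
  qed
qed

text \<open>
  This is the defining inequality of the class, multiplied by the coordinate sum. That inequality
  excludes multiples of the \<open>i\<close>-th basis vector, for which the left-hand side is \<open>0\<close>.
\<close>

lemma psi_gauge_zero_coord_le:
  fixes x :: "real ^ 'n::finite"
  assumes "\<psi> \<in> Psi" and x: "\<And>i. 0 \<le> x $ i"
  shows "psi_gauge \<psi> (\<chi> j. if j = i then 0 else x $ j) \<le> psi_gauge \<psi> x"
    (is "psi_gauge \<psi> ?z \<le> _")
proof -
  define S where "S = (\<Sum>j\<in>UNIV. x $ j)"
  have S: "0 \<le> S"
    unfolding S_def using x by (rule sum_nonneg_vec)
  have sumz: "(\<Sum>j\<in>UNIV. ?z $ j) = S - x $ i"
  proof -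
    have "S = x $ i + (\<Sum>j\<in>UNIV - {i}. x $ j)"
      unfolding S_def by (simp add: sum.remove)
    moreover have "(\<Sum>j\<in>UNIV. ?z $ j) = (\<Sum>j\<in>UNIV - {i}. x $ j)"
      by (intro sum.mono_neutral_cong_right) auto
    ultimately show ?thesis by simp
  qed
  have z: "\<And>j. 0 \<le> ?z $ j"
    using x by simp
  show ?thesis
  proof (cases "x $ i = S")
    case True
    then have "?z = 0"
      using nonneg_vec_eq_0_if_sum_eq_0[of ?z] z sumz by simp
    then have "x = axis i (x $ i)"
      by (simp add: vec_eq_iff axis_def) metis
    then have "psi_gauge \<psi> x = x $ i"
      using psi_gauge_axis[OF assms(1)] by metis
    with \<open>?z = 0\<close> x[of i] show ?thesis by simp
  next
    case False
    moreover have "0 \<le> S - x $ i"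
      using sum_nonneg_vec[of ?z] z sumz by simp
    ultimately have less: "x $ i < S" by simp
    then have "0 < S"
      using x[of i] by linarith
    define t where "t = (\<chi> j. x $ j / S)"
    have "t \<in> Omega" "t $ i < 1"
      using normalised_in_Omega[of x] x \<open>0 < S\<close> less by (auto simp: t_def S_def)
    then have "(1 - t $ i) * \<psi> (\<chi> j. if j = i then 0 else t $ j / (1 - t $ i)) \<le> \<psi> t"
      using assms(1) by (simp add: Psi_def)
    also have "(\<chi> j. if j = i then 0 else t $ j / (1 - t $ i)) = (\<chi> j. ?z $ j / (S - x $ i))"
      using \<open>0 < S\<close> less by (simp add: vec_eq_iff t_def field_simps)
    finally have "S * ((1 - t $ i) * \<psi> (\<chi> j. ?z $ j / (S - x $ i))) \<le> S * \<psi> t"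
      using S by (rule mult_left_mono)
    moreover have "S * (1 - t $ i) = S - x $ i"
      using \<open>0 < S\<close> by (simp add: t_def field_simps)
    ultimately have "(S - x $ i) * \<psi> (\<chi> j. ?z $ j / (S - x $ i)) \<le> S * \<psi> t"
      by (simp add: mult.assoc[symmetric])
    then show ?thesis
      by (simp only: psi_gauge_def sumz t_def S_def)
  qed
qed

text \<open>
  The vector with the decreased coordinate is a convex combination of \<open>x\<close> and of \<open>x\<close> with that
  coordinate removed, and the gauge of the latter is at most that of \<open>x\<close>.
\<close>

lemma psi_gauge_decrease_coord_le:
  fixes x :: "real ^ 'n::finite"
  assumes "\<psi> \<in> Psi" and x: "\<And>i. 0 \<le> x $ i" and c: "0 \<le> c" "c \<le> x $ i"
  shows "psi_gauge \<psi> (\<chi> j. if j = i then c else x $ j) \<le> psi_gauge \<psi> x"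
proof (cases "x $ i = 0")
  case True
  then have "(\<chi> j. if j = i then c else x $ j) = x"
    using c by (simp add: vec_eq_iff)
  then show ?thesis by simp
next
  case False
  \<comment> \<open>The weight for which the \<open>i\<close>-th coordinate of the combination is \<open>c\<close>.\<close>
  define r where "r = c / x $ i"
  define z where "z = (\<chi> j. if j = i then 0 else x $ j)"
  have r: "0 \<le> r" "r \<le> 1"
    using c x[of i] False by (auto simp: r_def divide_simps)
  have "(\<chi> j. if j = i then c else x $ j) = r *\<^sub>R x + (1 - r) *\<^sub>R z"
    using False by (simp add: vec_eq_iff r_def z_def algebra_simps)
  then have "psi_gauge \<psi> (\<chi> j. if j = i then c else x $ j)
      \<le> psi_gauge \<psi> (r *\<^sub>R x) + psi_gauge \<psi> ((1 - r) *\<^sub>R z)"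
    using psi_gauge_add_le[OF assms(1), of "r *\<^sub>R x" "(1 - r) *\<^sub>R z"] r x
    by (simp add: z_def)
  also have "\<dots> = r * psi_gauge \<psi> x + (1 - r) * psi_gauge \<psi> z"
    by (simp add: psi_gauge_scaleR)
  also have "\<dots> \<le> r * psi_gauge \<psi> x + (1 - r) * psi_gauge \<psi> x"
    using psi_gauge_zero_coord_le[OF assms(1), of x i] x r
    by (intro add_left_mono mult_left_mono) (auto simp: z_def)
  finally show ?thesis
    by (simp add: algebra_simps)
qed

text \<open>Pass from \<open>y\<close> to \<open>x\<close> by decreasing one coordinate after the other.\<close>

lemma psi_gauge_mono:
  fixes x y :: "real ^ 'n::finite"
  assumes "\<psi> \<in> Psi" and x: "\<And>i. 0 \<le> x $ i" and le: "\<And>i. x $ i \<le> y $ i"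
  shows "psi_gauge \<psi> x \<le> psi_gauge \<psi> y"
proof -
  have "psi_gauge \<psi> (\<chi> j. if j \<in> A then x $ j else y $ j) \<le> psi_gauge \<psi> y" for A
    using finite[of A]
  proof (induction A rule: finite_induct)
    case empty
    then show ?case by simp
  next
    case (insert i A)
    let ?w = "\<chi> j. if j \<in> A then x $ j else y $ j"
    have "(\<chi> j. if j \<in> insert i A then x $ j else y $ j) = (\<chi> j. if j = i then x $ i else ?w $ j)"
      by (auto simp: vec_eq_iff)
    moreover have "psi_gauge \<psi> (\<chi> j. if j = i then x $ i else ?w $ j) \<le> psi_gauge \<psi> ?w"
      using x le insert.hyps order_trans[OF x le]
      by (intro psi_gauge_decrease_coord_le assms(1)) auto
    ultimately show ?case
      using insert.IH by simp
  qed
  from this[of UNIV] show ?thesis by simp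
qed

lemma coord_le_psi_gauge:
  fixes x :: "real ^ 'n::finite"
  assumes "\<psi> \<in> Psi" and x: "\<And>i. 0 \<le> x $ i"
  shows "x $ i \<le> psi_gauge \<psi> x"
proof -
  have "psi_gauge \<psi> (axis i (x $ i)) \<le> psi_gauge \<psi> x"
    using x by (intro psi_gauge_mono assms(1)) (auto simp: axis_def)
  then show ?thesis
    by (simp add: psi_gauge_axis[OF assms(1)])
qed

lemma psi_gauge_nonneg:
  fixes x :: "real ^ 'n::finite"
  assumes "\<psi> \<in> Psi" and x: "\<And>i. 0 \<le> x $ i"
  shows "0 \<le> psi_gauge \<psi> x"
  using coord_le_psi_gauge[OF assms, of undefined] x[of undefined] by linarith

section \<open>The product metric\<close>

lemma dist_psi_neq:
  "x \<noteq> y \<Longrightarrow> dist_psi \<psi> d x y = psi_gauge \<psi> (\<chi> i. d i (x i) (y i))"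
  by (simp add: dist_psi_def psi_gauge_def Let_def)

text \<open>
  Within the product of the carriers the separate clause for \<open>x = y\<close> in the definition of
  \<open>dist_psi\<close> agrees with the value of the gauge at the origin; outside of it
  \<open>d i (x i) (x i)\<close> may be nonzero.
\<close>

lemma dist_psi_eq_psi_gauge:
  assumes "\<And>i. Metric_space (X i) (d i)" "x \<in> Pi UNIV X" "y \<in> Pi UNIV X"
  shows "dist_psi \<psi> d x y = psi_gauge \<psi> (\<chi> i. d i (x i) (y i))"
proof (cases "x = y")
  case True
  have "d i (x i) (x i) = 0" for i
    using assms Metric_space.mdist_zero[of "X i" "d i" "x i"] by (auto simp: Pi_iff)
  then have "(\<chi> i. d i (x i) (y i)) = 0"
    using True by (simp add: vec_eq_iff)
  then show ?thesis
    using True by (simp add: dist_psi_def)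
qed (rule dist_psi_neq)

lemma Metric_space_dist_psi:
  fixes X :: "'n::finite \<Rightarrow> 'a set"
  assumes ms: "\<And>i. Metric_space (X i) (d i)" and psi: "\<psi> \<in> Psi"
  shows "Metric_space (Pi UNIV X) (dist_psi \<psi> d)"
proof
  have nonneg: "0 \<le> d i p q" and comm: "d i p q = d i q p" for i p q
    using ms[of i] by (auto simp: Metric_space_def)
  show "0 \<le> dist_psi \<psi> d x y" for x y
    by (cases "x = y") (auto simp: dist_psi_def[of _ _ y y] dist_psi_neq nonneg intro!: psi_gauge_nonneg[OF psi])
  show "dist_psi \<psi> d x y = dist_psi \<psi> d y x" for x y
    by (cases "x = y") (auto simp: dist_psi_neq comm)
  show "dist_psi \<psi> d x y = 0 \<longleftrightarrow> x = y" if "x \<in> Pi UNIV X" "y \<in> Pi UNIV X" for x y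
  proof
    assume "dist_psi \<psi> d x y = 0"
    then have "psi_gauge \<psi> (\<chi> i. d i (x i) (y i)) = 0"
      using that by (simp add: dist_psi_eq_psi_gauge[OF ms])
    then have "d i (x i) (y i) \<le> 0" for i
      using coord_le_psi_gauge[OF psi, of "\<chi> i. d i (x i) (y i)" i] nonneg by simp
    then have "d i (x i) (y i) = 0" for i
      using nonneg order_antisym by blast
    then show "x = y"
      using that Metric_space.zero[OF ms] by (auto simp: Pi_iff)
  qed (simp add: dist_psi_def)
  show "dist_psi \<psi> d x z \<le> dist_psi \<psi> d x y + dist_psi \<psi> d y z"
    if "x \<in> Pi UNIV X" "y \<in> Pi UNIV X" "z \<in> Pi UNIV X" for x y z
  proof -
    let ?v = "\<lambda>x y. \<chi> i. d i (x i) (y i)"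
    have "psi_gauge \<psi> (?v x z) \<le> psi_gauge \<psi> (?v x y + ?v y z)"
      using that Metric_space.triangle[OF ms]
      by (intro psi_gauge_mono psi) (auto simp: nonneg Pi_iff)
    also have "\<dots> \<le> psi_gauge \<psi> (?v x y) + psi_gauge \<psi> (?v y z)"
      by (intro psi_gauge_add_le psi) (auto simp: nonneg)
    finally show ?thesis
      using that by (simp add: dist_psi_eq_psi_gauge[OF ms])
  qed
qed

section \<open>Length spaces and Lipschitz paths\<close>

text \<open>
  It suffices to demand the estimate for \<open>s \<le> t\<close>, because \<open>d\<close> will be symmetric; the constant
  can then multiply \<open>t - s\<close> without an absolute value.
\<close>

definition lipschitz_path ::
  "'a set \<Rightarrow> ('a \<Rightarrow> 'a \<Rightarrow> real) \<Rightarrow> real \<Rightarrow> 'a \<Rightarrow> 'a \<Rightarrow> (real \<Rightarrow> 'a) \<Rightarrow> bool" where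
  "lipschitz_path X d L u v \<tau> \<longleftrightarrow>
     \<tau> \<in> {0..1} \<rightarrow> X \<and> \<tau> 0 = u \<and> \<tau> 1 = v \<and>
     (\<forall>s t. 0 \<le> s \<longrightarrow> s \<le> t \<longrightarrow> t \<le> 1 \<longrightarrow> d (\<tau> s) (\<tau> t) \<le> L * (t - s))"

lemma curve_iff:
  assumes "Metric_space X d"
  shows "curve X d a b \<sigma> \<longleftrightarrow> a \<le> b \<and> \<sigma> \<in> {a..b} \<rightarrow> X \<and>
    (\<forall>x\<in>{a..b}. \<forall>e>0. \<exists>\<delta>>0. \<forall>y\<in>{a..b}. \<bar>y - x\<bar> < \<delta> \<longrightarrow> d (\<sigma> x) (\<sigma> y) < e)"
proof -
  interpret Metric_space X d by fact
  have "continuous_map (top_of_set {a..b}) mtopology \<sigma> \<longleftrightarrow> \<sigma> \<in> {a..b} \<rightarrow> X \<and>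
    (\<forall>x\<in>{a..b}. \<forall>e>0. \<exists>\<delta>>0. \<forall>y\<in>{a..b}. \<bar>y - x\<bar> < \<delta> \<longrightarrow> d (\<sigma> x) (\<sigma> y) < e)"
    (is "?L \<longleftrightarrow> ?R1 \<and> ?R2")
  proof (intro iffI conjI)
    assume L: ?L
    then show R1: ?R1
      using continuous_map_funspace by fastforce
    show ?R2
    proof (intro ballI allI impI)
      fix x e :: real
      assume "x \<in> {a..b}" "0 < e"
      then obtain U where U: "openin (top_of_set {a..b}) U" "x \<in> U" "\<forall>y\<in>U. \<sigma> y \<in> mball (\<sigma> x) e"
        using L unfolding continuous_map_to_metric by (metis topspace_euclidean_subtopology)
      then obtain \<delta> where "0 < \<delta>" "ball x \<delta> \<inter> {a..b} \<subseteq> U"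
        unfolding openin_contains_ball by blast
      with U show "\<exists>\<delta>>0. \<forall>y\<in>{a..b}. \<bar>y - x\<bar> < \<delta> \<longrightarrow> d (\<sigma> x) (\<sigma> y) < e"
        by (intro exI[of _ \<delta>]) (auto simp: subset_iff dist_real_def abs_minus_commute)
    qed
  next
    assume R: "?R1 \<and> ?R2"
    show ?L
      unfolding continuous_map_to_metric
    proof (intro ballI allI impI)
      fix x e :: real
      assume "x \<in> topspace (top_of_set {a..b})" "0 < e"
      then have x: "x \<in> {a..b}" by simp
      then obtain \<delta> where "0 < \<delta>" "\<forall>y\<in>{a..b}. \<bar>y - x\<bar> < \<delta> \<longrightarrow> d (\<sigma> x) (\<sigma> y) < e"
        using R \<open>0 < e\<close> by blast
      then show "\<exists>U. openin (top_of_set {a..b}) U \<and> x \<in> U \<and> (\<forall>y\<in>U. \<sigma> y \<in> mball (\<sigma> x) e)"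
        using x R by (intro exI[of _ "{a..b} \<inter> ball x \<delta>"])
          (auto simp: openin_open_Int dist_real_def abs_minus_commute Pi_iff)
    qed
  qed
  then show ?thesis
    by (simp add: curve_def)
qed

lemma partition_strict_mono:
  fixes t :: "nat \<Rightarrow> real"
  assumes "\<forall>i\<in>{1..m}. t (i - 1) < t i" "i < j" "j \<le> m"
  shows "t i < t j"
  using assms(2,3)
proof (induction j)
  case (Suc j)
  have "t j < t (Suc j)"
    using assms(1) Suc.prems by force
  then show ?case
    using Suc by (cases "i = j") auto
qed simp

text \<open>An interval of length zero has no partition, and the supremum of the empty set is \<open>0\<close>.\<close>

lemma curve_length_refl: "curve_length d a a \<sigma> = 0"
proof -
  have "{\<Sum>i=1..m. ennreal (d (\<sigma> (t (i - 1))) (\<sigma> (t i))) | (m::nat) (t::nat \<Rightarrow> real).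
            1 \<le> m \<and> t 0 = a \<and> t m = a \<and> (\<forall>i\<in>{1..m}. t (i - 1) < t i)} = {}"
  proof (rule equals0I, clarify)
    fix m :: nat and t :: "nat \<Rightarrow> real"
    assume "1 \<le> m" "a = t 0" "t m = t 0" "\<forall>i\<in>{1..m}. t (i - 1) < t i"
    then show False
      using partition_strict_mono[of m t 0 m] by simp
  qed
  then show ?thesis
    unfolding curve_length_def by (simp only: Sup_empty bot_ennreal)
qed

lemma dist_le_curve_length:
  assumes "a < b"
  shows "ennreal (d (\<sigma> a) (\<sigma> b)) \<le> curve_length d a b \<sigma>"
  unfolding curve_length_def
  using assms
  by (intro Sup_upper CollectI exI[of _ "1::nat"] exI[of _ "\<lambda>i::nat. if i = 0 then a else b"]) auto

text \<open>Append \<open>t\<close> to the partitions of the interval from \<open>a\<close> to \<open>s\<close>.\<close>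

lemma curve_length_extend:
  assumes "a < s" "s < t"
  shows "curve_length d a s \<sigma> + ennreal (d (\<sigma> s) (\<sigma> t)) \<le> curve_length d a t \<sigma>"
proof -
  let ?P = "\<lambda>s S. \<exists>(m::nat) (p::nat \<Rightarrow> real). S = (\<Sum>i=1..m. ennreal (d (\<sigma> (p (i - 1))) (\<sigma> (p i)))) \<and>
            1 \<le> m \<and> p 0 = a \<and> p m = s \<and> (\<forall>i\<in>{1..m}. p (i - 1) < p i)"
  let ?e = "ennreal (d (\<sigma> s) (\<sigma> t))"
  have step: "S + ?e \<le> curve_length d a t \<sigma>" if S: "?P s S" for S
  proof -
    obtain m :: nat and p :: "nat \<Rightarrow> real" where p: "S = (\<Sum>i=1..m. ennreal (d (\<sigma> (p (i - 1))) (\<sigma> (p i))))"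
            "1 \<le> m" "p 0 = a" "p m = s" "\<forall>i\<in>{1..m}. p (i - 1) < p i"
      using S by blast
    define q where "q = p(Suc m := t)"
    have "(\<Sum>i=1..Suc m. ennreal (d (\<sigma> (q (i - 1))) (\<sigma> (q i)))) =
      (\<Sum>i=1..m. ennreal (d (\<sigma> (q (i - 1))) (\<sigma> (q i)))) + ennreal (d (\<sigma> (q m)) (\<sigma> (q (Suc m))))"
      by simp
    also have "(\<Sum>i=1..m. ennreal (d (\<sigma> (q (i - 1))) (\<sigma> (q i)))) = S"
      unfolding p(1) by (intro sum.cong) (auto simp: q_def)
    also have "ennreal (d (\<sigma> (q m)) (\<sigma> (q (Suc m)))) = ?e"
      using p by (simp add: q_def)
    finally have "S + ?e = (\<Sum>i=1..Suc m. ennreal (d (\<sigma> (q (i - 1))) (\<sigma> (q i))))" ..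
    moreover have "q (i - 1) < q i" if "i \<in> {1..Suc m}" for i
      using that p(4,5) assms(2) by (cases "i = Suc m") (auto simp: q_def)
    ultimately have "?P t (S + ?e)"
      using p by (intro exI[of _ "Suc m"] exI[of _ q]) (auto simp: q_def)
    then show ?thesis
      unfolding curve_length_def by (intro Sup_upper) simp
  qed
  have ne: "{S. ?P s S} \<noteq> {}"
    using assms(1) by (auto intro!: exI[of _ "1::nat"] exI[of _ "\<lambda>i::nat. if i = 0 then a else s"])
  have "curve_length d a s \<sigma> + ?e = (SUP S\<in>{S. ?P s S}. S) + ?e"
    by (simp add: curve_length_def)
  also have "\<dots> = (SUP S\<in>{S. ?P s S}. S + ?e)"
    using ne by (rule ennreal_SUP_add_left[symmetric])
  also have "\<dots> \<le> curve_length d a t \<sigma>"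
    using step by (intro SUP_least) simp
  finally show ?thesis .
qed

text \<open>
  The increments of arc length bound distances along the curve; from this the reparametrisation
  obtains its Lipschitz constant.
\<close>

lemma curve_length_le_add:
  assumes "Metric_space X d" "\<sigma> \<in> {a..t} \<rightarrow> X" "a \<le> s" "s \<le> t"
  shows "curve_length d a s \<sigma> + ennreal (d (\<sigma> s) (\<sigma> t)) \<le> curve_length d a t \<sigma>"
proof -
  consider "s = t" | "a = s" "s < t" | "a < s" "s < t"
    using assms by linarith
  then show ?thesis
  proof cases
    case 1
    then have "d (\<sigma> s) (\<sigma> t) = 0"
      using assms Metric_space.mdist_zero[OF assms(1)] by (simp add: Pi_iff)
    then show ?thesis
      using 1 by simp
  next
    case 2
    then show ?thesis
      by (simp add: curve_length_refl dist_le_curve_length)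
  next
    case 3
    then show ?thesis
      by (rule curve_length_extend)
  qed
qed

text \<open>
  By continuity a bound on the distances strictly between two parameters extends to the
  endpoints. The reparametrisation below needs this because a supremum of parameters, by which it is
  defined, is controlled only through the parameters on either side of it.
\<close>

lemma curve_dist_endpoints_le:
  assumes ms: "Metric_space X d" and curve: "curve X d a b \<sigma>"
    and xy: "a \<le> x" "x < y" "y \<le> b"
    and inner: "\<And>p q. x < p \<Longrightarrow> p < q \<Longrightarrow> q < y \<Longrightarrow> d (\<sigma> p) (\<sigma> q) \<le> K"
  shows "d (\<sigma> x) (\<sigma> y) \<le> K"
proof (rule field_le_epsilon)
  fix e :: real assume "0 < e"
  interpret Metric_space X d by fact
  have X: "\<sigma> t \<in> X" if "a \<le> t" "t \<le> b" for t
    using curve that by (auto simp: curve_iff[OF ms])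
  have cont: "\<exists>\<delta>>0. \<forall>r\<in>{a..b}. \<bar>r - t\<bar> < \<delta> \<longrightarrow> d (\<sigma> t) (\<sigma> r) < e / 2" if "t \<in> {a..b}" for t
    using curve that \<open>0 < e\<close> half_gt_zero[of e] unfolding curve_iff[OF ms] by blast
  obtain \<delta>1 where \<delta>1: "0 < \<delta>1" "\<And>r. r \<in> {a..b} \<Longrightarrow> \<bar>r - x\<bar> < \<delta>1 \<Longrightarrow> d (\<sigma> x) (\<sigma> r) < e / 2"
    using cont[of x] xy by auto
  obtain \<delta>2 where \<delta>2: "0 < \<delta>2" "\<And>r. r \<in> {a..b} \<Longrightarrow> \<bar>r - y\<bar> < \<delta>2 \<Longrightarrow> d (\<sigma> y) (\<sigma> r) < e / 2"
    using cont[of y] xy by auto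
  \<comment> \<open>One third keeps \<open>x + h\<close> to the left of \<open>y - h\<close>.\<close>
  define h where "h = min (y - x) (min \<delta>1 \<delta>2) / 3"
  have h: "0 < h" "h < \<delta>1" "h < \<delta>2" "3 * h \<le> y - x"
    using \<delta>1(1) \<delta>2(1) xy by (auto simp: h_def min_def)
  define p q where "p = x + h" and "q = y - h"
  have pq: "x < p" "p < q" "q < y"
    using h by (auto simp: p_def q_def)
  have "d (\<sigma> x) (\<sigma> y) \<le> d (\<sigma> x) (\<sigma> p) + d (\<sigma> p) (\<sigma> y)"
    using xy pq by (intro triangle X) auto
  also have "d (\<sigma> p) (\<sigma> y) \<le> d (\<sigma> p) (\<sigma> q) + d (\<sigma> q) (\<sigma> y)"
    using xy pq by (intro triangle X) auto
  also have "d (\<sigma> p) (\<sigma> q) \<le> K"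
    using pq by (rule inner)
  finally show "d (\<sigma> x) (\<sigma> y) \<le> K + e"
    using \<delta>1(2)[of p] \<delta>2(2)[of q] xy pq h commute[of "\<sigma> y" "\<sigma> q"] by (auto simp: p_def q_def)
qed

text \<open>
  At time \<open>s\<close> the new path is where the curve is at the last parameter \<open>\<theta> s\<close> at which it has
  consumed at most the fraction \<open>s\<close> of its length \<open>L\<close>, understood as a supremum. Strictly between \<open>\<theta> s\<close>
  and \<open>\<theta> t\<close> the arc length lies between \<open>L * s\<close> and \<open>L * t\<close>, so distances there are at most
  \<open>L * (t - s)\<close>, and by \<open>curve_dist_endpoints_le\<close> this remains true for the endpoints.
\<close>

lemma curve_imp_lipschitz_path:
  assumes ms: "Metric_space X d" and curve: "curve X d a b \<sigma>"
    and rect: "rectifiable d a b \<sigma>"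
  shows "\<exists>\<tau>. lipschitz_path X d (enn2real (curve_length d a b \<sigma>)) (\<sigma> a) (\<sigma> b) \<tau>"
proof -
  interpret Metric_space X d by fact
  define len where "len t = enn2real (curve_length d a t \<sigma>)" for t
  define L where "L = len b"
  have ab: "a \<le> b" and X: "\<sigma> \<in> {a..b} \<rightarrow> X"
    using curve by (auto simp: curve_iff[OF ms])
  have add: "curve_length d a s \<sigma> + ennreal (d (\<sigma> s) (\<sigma> t)) \<le> curve_length d a t \<sigma>"
    if "a \<le> s" "s \<le> t" "t \<le> b" for s t
    using that X by (intro curve_length_le_add[OF ms]) (auto simp: Pi_iff)
  have finite_length: "curve_length d a t \<sigma> = ennreal (len t)" if "a \<le> t" "t \<le> b" for t
  proof -
    have "curve_length d a t \<sigma> \<le> curve_length d a b \<sigma>"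
      using add[of t b] that by (auto intro: order_trans[OF le_iff_add[THEN iffD2]])
    also have "\<dots> < top"
      using rect by (simp add: rectifiable_def)
    finally show ?thesis
      by (simp add: len_def)
  qed
  have len_nonneg: "0 \<le> len t" for t
    by (simp add: len_def)
  have dist_le: "d (\<sigma> s) (\<sigma> t) \<le> len t - len s" if "a \<le> s" "s \<le> t" "t \<le> b" for s t
    using add[OF that] that finite_length[of s] finite_length[of t] len_nonneg
    by (simp add: le_diff_eq add.commute flip: ennreal_plus)
  have len_mono: "len s \<le> len t" if "a \<le> s" "s \<le> t" "t \<le> b" for s t
    using dist_le[OF that] nonneg[of "\<sigma> s" "\<sigma> t"] by linarith
  have len_a: "len a = 0"
    by (simp add: len_def curve_length_refl)
  define \<theta> where "\<theta> s = Sup {t \<in> {a..b}. len t \<le> L * s}" for s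
  have bdd: "bdd_above {t \<in> {a..b}. len t \<le> L * s}" for s
    by (rule bdd_aboveI[of _ b]) auto
  have a_in: "a \<in> {t \<in> {a..b}. len t \<le> L * s}" if "0 \<le> s" for s
    using that ab len_nonneg by (auto simp: len_a L_def)
  have \<theta>_range: "a \<le> \<theta> s" "\<theta> s \<le> b" if "0 \<le> s" for s
    using a_in[OF that] unfolding \<theta>_def by (auto intro!: cSup_upper bdd cSup_least)
  have above: "L * s < len p" if "\<theta> s < p" "a \<le> p" "p \<le> b" for s p
  proof (rule ccontr)
    assume "\<not> L * s < len p"
    then have "p \<le> \<theta> s"
      unfolding \<theta>_def using that by (intro cSup_upper bdd) auto
    then show False using that by simp
  qed
  have below: "len q \<le> L * s" if "q < \<theta> s" "a \<le> q" "0 \<le> s" for s q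
  proof -
    obtain r where "r \<in> {t \<in> {a..b}. len t \<le> L * s}" "q < r"
      using \<open>q < \<theta> s\<close> less_cSup_iff[OF _ bdd] a_in[OF \<open>0 \<le> s\<close>] unfolding \<theta>_def by blast
    then show ?thesis
      using len_mono[of q r] that by auto
  qed
  \<comment> \<open>Up to \<open>\<theta> 0\<close> the curve has travelled no distance, although \<open>\<theta> 0\<close> may exceed \<open>a\<close>.\<close>
  have start: "\<sigma> (\<theta> 0) = \<sigma> a"
  proof (cases "\<theta> 0 = a")
    case False
    then have range0: "a < \<theta> 0" "\<theta> 0 \<le> b"
      using \<theta>_range[of 0] by auto
    have "d (\<sigma> a) (\<sigma> (\<theta> 0)) \<le> 0"
    proof (rule curve_dist_endpoints_le[OF ms curve order.refl range0])
      fix p q assume "a < p" "p < q" "q < \<theta> 0"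
      then show "d (\<sigma> p) (\<sigma> q) \<le> 0"
        using dist_le[of p q] below[of q 0] len_nonneg[of p] range0(2) by auto
    qed
    then have "d (\<sigma> a) (\<sigma> (\<theta> 0)) = 0"
      using nonneg order_antisym by blast
    moreover have "\<sigma> a \<in> X" "\<sigma> (\<theta> 0) \<in> X"
      using X range0 by (auto simp: Pi_iff)
    ultimately show ?thesis by simp
  qed simp
  have stop: "\<theta> 1 = b"
    using above[of 1 b] \<theta>_range[of 1] ab by (fastforce simp: L_def)
  have lip: "d (\<sigma> (\<theta> s)) (\<sigma> (\<theta> t)) \<le> L * (t - s)" if "0 \<le> s" "s \<le> t" for s t
  proof -
    have "0 \<le> L"
      by (simp add: L_def len_nonneg)
    have "L * s \<le> L * t"
      using \<open>0 \<le> L\<close> that by (simp add: mult_left_mono)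
    then have "\<theta> s \<le> \<theta> t"
      unfolding \<theta>_def using a_in[OF that(1)] by (intro cSup_subset_mono bdd) auto
    show ?thesis
    proof (cases "\<theta> s = \<theta> t")
      case True
      moreover have "\<sigma> (\<theta> t) \<in> X"
        using X \<theta>_range[of t] that by (auto simp: Pi_iff)
      ultimately show ?thesis
        using \<open>0 \<le> L\<close> that by simp
    next
      case False
      then have "\<theta> s < \<theta> t"
        using \<open>\<theta> s \<le> \<theta> t\<close> by simp
      show ?thesis
      proof (rule curve_dist_endpoints_le[OF ms curve _ \<open>\<theta> s < \<theta> t\<close>])
        fix p q assume pq: "\<theta> s < p" "p < q" "q < \<theta> t"
        then have "a \<le> p" "q \<le> b"
          using \<theta>_range[of s] \<theta>_range[of t] that by auto
        then show "d (\<sigma> p) (\<sigma> q) \<le> L * (t - s)"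
          using dist_le[of p q] above[of s p] below[of q t] pq that by (simp add: right_diff_distrib)
      qed (use \<theta>_range that in auto)
    qed
  qed
  have "lipschitz_path X d L (\<sigma> a) (\<sigma> b) (\<sigma> \<circ> \<theta>)"
    unfolding lipschitz_path_def using X \<theta>_range start stop lip by (auto simp: Pi_iff)
  then show ?thesis
    unfolding L_def len_def by blast
qed

text \<open>On any partition the Lipschitz estimates add up to a telescoping sum.\<close>

lemma lipschitz_path_curve:
  assumes ms: "Metric_space X d" and \<tau>: "lipschitz_path X d L u v \<tau>"
  shows "curve X d 0 1 \<tau>" "curve_length d 0 1 \<tau> \<le> ennreal L"
proof -
  interpret Metric_space X d by fact
  have lip: "d (\<tau> s) (\<tau> t) \<le> L * (t - s)" if "0 \<le> s" "s \<le> t" "t \<le> 1" for s t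
    using \<tau> that by (simp add: lipschitz_path_def)
  have "0 \<le> L"
    using order_trans[OF nonneg lip[of 0 1]] by simp
  \<comment> \<open>Continuity compares parameters in either order.\<close>
  have lip_abs: "d (\<tau> s) (\<tau> t) \<le> L * \<bar>t - s\<bar>" if "s \<in> {0..1}" "t \<in> {0..1}" for s t
    using lip[of s t] lip[of t s] that commute[of "\<tau> s" "\<tau> t"] by (cases "s \<le> t") auto
  show "curve X d 0 1 \<tau>"
    unfolding curve_iff[OF ms]
  proof (intro conjI ballI allI impI)
    show "\<tau> \<in> {0..1} \<rightarrow> X"
      using \<tau> by (simp add: lipschitz_path_def)
    fix x e :: real assume x: "x \<in> {0..1}" and "0 < e"
    have "d (\<tau> x) (\<tau> y) < e" if "y \<in> {0..1}" "\<bar>y - x\<bar> < e / (L + 1)" for y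
    proof -
      have "d (\<tau> x) (\<tau> y) \<le> L * \<bar>y - x\<bar>"
        using x that by (intro lip_abs)
      also have "\<dots> \<le> (L + 1) * \<bar>y - x\<bar>"
        by (intro mult_right_mono) auto
      also have "\<dots> < e"
        using that \<open>0 \<le> L\<close> by (simp add: field_simps)
      finally show ?thesis .
    qed
    then show "\<exists>\<delta>>0. \<forall>y\<in>{0..1}. \<bar>y - x\<bar> < \<delta> \<longrightarrow> d (\<tau> x) (\<tau> y) < e"
      using \<open>0 < e\<close> \<open>0 \<le> L\<close> by (intro exI[of _ "e / (L + 1)"]) auto
  qed simp
  show "curve_length d 0 1 \<tau> \<le> ennreal L"
    unfolding curve_length_def
  proof (rule Sup_least, clarify)
    fix m :: nat and t :: "nat \<Rightarrow> real"
    assume t: "t 0 = 0" "t m = 1" "\<forall>i\<in>{1..m}. t (i - 1) < t i"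
    have mono: "t i \<le> t j" if "i \<le> j" "j \<le> m" for i j
      using partition_strict_mono[OF t(3), of i j] that by (cases "i = j") auto
    have "(\<Sum>i=1..m. ennreal (d (\<tau> (t (i - 1))) (\<tau> (t i)))) = ennreal (\<Sum>i=1..m. d (\<tau> (t (i - 1))) (\<tau> (t i)))"
      by (simp add: sum_ennreal)
    also have "\<dots> \<le> ennreal (\<Sum>i=1..m. L * (t i - t (i - 1)))"
    proof (intro ennreal_leI sum_mono lip)
      fix i assume "i \<in> {1..m}"
      then show "0 \<le> t (i - 1)" "t (i - 1) \<le> t i" "t i \<le> 1"
        using mono[of 0 "i - 1"] mono[of "i - 1" i] mono[of i m] t by auto
    qed
    also have "(\<Sum>i=1..m. L * (t i - t (i - 1))) = L"
      using t sum_telescope''[of 0 m t] by (simp flip: sum_distrib_left add: atLeastSucAtMost_greaterThanAtMost)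
    finally show "(\<Sum>i=1..m. ennreal (d (\<tau> (t (i - 1))) (\<tau> (t i)))) \<le> ennreal L" .
  qed
qed

lemma dist_endpoints_le_curve_length:
  assumes ms: "Metric_space X d" and curve: "curve X d a b \<sigma>"
  shows "ennreal (d (\<sigma> a) (\<sigma> b)) \<le> curve_length d a b \<sigma>"
  using curve_length_le_add[OF ms, of \<sigma> a b a] curve
  by (auto simp: curve_iff[OF ms] curve_length_refl)

lemma lipschitz_path_mono:
  assumes "lipschitz_path X d L u v \<tau>" "L \<le> L'"
  shows "lipschitz_path X d L' u v \<tau>"
proof -
  have "L * (t - s) \<le> L' * (t - s)" if "s \<le> t" for s t :: real
    using assms(2) that by (simp add: mult_right_mono)
  then show ?thesis
    using assms(1) unfolding lipschitz_path_def by (meson order_trans)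
qed

text \<open>
  The length of a curve never falls below the distance of its endpoints, so being a length space
  only asks for rectifiable curves of length arbitrarily close to the distance, and these may be
  replaced by Lipschitz paths on the unit interval.
\<close>

lemma length_space_iff_lipschitz_paths:
  "length_space X d \<longleftrightarrow> Metric_space X d \<and>
     (\<forall>u\<in>X. \<forall>v\<in>X. \<forall>e>0. \<exists>\<tau>. lipschitz_path X d (d u v + e) u v \<tau>)"
proof (cases "Metric_space X d")
  case ms: True
  interpret Metric_space X d by fact
  let ?C = "\<lambda>u v. {curve_length d a b \<sigma> | a b \<sigma>.
               curve X d a b \<sigma> \<and> rectifiable d a b \<sigma> \<and> \<sigma> a = u \<and> \<sigma> b = v}"
  have "ennreal (d u v) = Inf (?C u v) \<longleftrightarrow> (\<forall>e>0. \<exists>\<tau>. lipschitz_path X d (d u v + e) u v \<tau>)" for u v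
  proof (intro iffI allI impI)
    fix e :: real assume "ennreal (d u v) = Inf (?C u v)" "0 < e"
    then have "Inf (?C u v) < ennreal (d u v + e)"
      by (metis ennreal_less_iff nonneg less_add_same_cancel1)
    then obtain a b \<sigma> where \<sigma>: "curve_length d a b \<sigma> < ennreal (d u v + e)"
      "curve X d a b \<sigma>" "rectifiable d a b \<sigma>" "\<sigma> a = u" "\<sigma> b = v"
      unfolding Inf_less_iff by blast
    then obtain \<tau> where "lipschitz_path X d (enn2real (curve_length d a b \<sigma>)) u v \<tau>"
      using curve_imp_lipschitz_path[OF ms] by blast
    moreover have "enn2real (curve_length d a b \<sigma>) \<le> d u v + e"
      using \<sigma>(1) \<open>0 < e\<close> by (intro enn2real_leI) auto
    ultimately have "lipschitz_path X d (d u v + e) u v \<tau>"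
      by (rule lipschitz_path_mono)
    then show "\<exists>\<tau>. lipschitz_path X d (d u v + e) u v \<tau>"
      by (rule exI[of _ \<tau>])
  next
    assume R: "\<forall>e>0. \<exists>\<tau>. lipschitz_path X d (d u v + e) u v \<tau>"
    show "ennreal (d u v) = Inf (?C u v)"
    proof (rule antisym)
      show "ennreal (d u v) \<le> Inf (?C u v)"
        using dist_endpoints_le_curve_length[OF ms] by (intro Inf_greatest) blast
      show "Inf (?C u v) \<le> ennreal (d u v)"
      proof (rule ennreal_le_epsilon)
        fix e :: real assume "0 < e"
        then obtain \<tau> where \<tau>: "lipschitz_path X d (d u v + e) u v \<tau>"
          using R by blast
        note lipschitz_path_curve[OF ms \<tau>]
        moreover from this(2) have "curve_length d 0 1 \<tau> < \<infinity>"
          by (auto intro: le_less_trans)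
        ultimately have "Inf (?C u v) \<le> ennreal (d u v + e)"
          using \<tau> unfolding rectifiable_def lipschitz_path_def
          by (intro Inf_lower2[of "curve_length d 0 1 \<tau>"]) blast+
        then show "Inf (?C u v) \<le> ennreal (d u v) + ennreal e"
          using \<open>0 < e\<close> by (simp add: ennreal_plus)
      qed
    qed
  qed
  then show ?thesis
    using ms by (simp add: length_space_def)
qed (simp add: length_space_def)

section \<open>Products of length spaces\<close>

lemma length_space_prod:
  fixes X :: "'n::finite \<Rightarrow> 'a set"
  assumes ls: "\<And>i. length_space (X i) (d i)" and psi: "\<psi> \<in> Psi"
  shows "length_space (Pi UNIV X) (dist_psi \<psi> d)"
  unfolding length_space_iff_lipschitz_paths
proof (intro conjI ballI allI impI)
  have ms: "Metric_space (X i) (d i)" for i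
    using ls by (simp add: length_space_def)
  have nonneg: "0 \<le> d i p q" for i p q
    using Metric_space.nonneg[OF ms] .
  show "Metric_space (Pi UNIV X) (dist_psi \<psi> d)"
    using ms psi by (rule Metric_space_dist_psi)
  fix u v and e :: real
  assume uv: "u \<in> Pi UNIV X" "v \<in> Pi UNIV X" and "0 < e"
  define one :: "real ^ 'n" where "one = (\<chi> i. 1)"
  define c where "c = psi_gauge \<psi> one"
  have "0 \<le> c"
    unfolding c_def by (rule psi_gauge_nonneg[OF psi]) (simp add: one_def)
  \<comment> \<open>The excess of each coordinate path, chosen such that the total excess \<open>h * c\<close> is at most \<open>e\<close>.\<close>
  define h where "h = e / (c + 1)"
  have h: "0 < h" "h * c \<le> e"
    using \<open>0 < e\<close> \<open>0 \<le> c\<close> by (auto simp: h_def field_simps)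
  have "\<forall>i. \<exists>\<tau>. lipschitz_path (X i) (d i) (d i (u i) (v i) + h) (u i) (v i) \<tau>"
    using ls uv \<open>0 < h\<close> unfolding length_space_iff_lipschitz_paths by (auto simp: Pi_iff)
  then obtain \<tau> where \<tau>: "\<And>i. lipschitz_path (X i) (d i) (d i (u i) (v i) + h) (u i) (v i) (\<tau> i)"
    by metis
  define D where "D = (\<chi> i. d i (u i) (v i))"
  have M: "(\<lambda>i. \<tau> i s) \<in> Pi UNIV X" if "0 \<le> s" "s \<le> 1" for s
    using \<tau> that by (auto simp: lipschitz_path_def Pi_iff)
  have "dist_psi \<psi> d (\<lambda>i. \<tau> i s) (\<lambda>i. \<tau> i t) \<le> (dist_psi \<psi> d u v + e) * (t - s)"
    if st: "0 \<le> s" "s \<le> t" "t \<le> 1" for s t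
  proof -
    have "dist_psi \<psi> d (\<lambda>i. \<tau> i s) (\<lambda>i. \<tau> i t) = psi_gauge \<psi> (\<chi> i. d i (\<tau> i s) (\<tau> i t))"
      using st M by (simp add: dist_psi_eq_psi_gauge[OF ms])
    also have "\<dots> \<le> psi_gauge \<psi> ((t - s) *\<^sub>R (D + h *\<^sub>R one))"
      using \<tau> st by (intro psi_gauge_mono[OF psi])
        (auto simp: D_def one_def nonneg lipschitz_path_def mult.commute)
    also have "\<dots> = (t - s) * psi_gauge \<psi> (D + h *\<^sub>R one)"
      by (rule psi_gauge_scaleR)
    also have "\<dots> \<le> (t - s) * (psi_gauge \<psi> D + psi_gauge \<psi> (h *\<^sub>R one))"
      using st h by (intro mult_left_mono psi_gauge_add_le[OF psi]) (auto simp: D_def one_def nonneg)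
    also have "\<dots> \<le> (t - s) * (psi_gauge \<psi> D + e)"
      using st h by (intro mult_left_mono) (auto simp: psi_gauge_scaleR c_def)
    also have "psi_gauge \<psi> D = dist_psi \<psi> d u v"
      using uv by (simp add: dist_psi_eq_psi_gauge[OF ms] D_def)
    finally show ?thesis
      by (simp add: mult.commute)
  qed
  then have "lipschitz_path (Pi UNIV X) (dist_psi \<psi> d) (dist_psi \<psi> d u v + e) u v (\<lambda>s i. \<tau> i s)"
    using \<tau> M by (auto simp: lipschitz_path_def)
  then show "\<exists>\<tau>. lipschitz_path (Pi UNIV X) (dist_psi \<psi> d) (dist_psi \<psi> d u v + e) u v \<tau>"
    by (rule exI[of _ "\<lambda>s i. \<tau> i s"])
qed

lemma length_space_factor:
  fixes X :: "'n::finite \<Rightarrow> 'a set"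
  assumes ms: "\<And>i. Metric_space (X i) (d i)" and ne: "\<And>i. X i \<noteq> {}" and psi: "\<psi> \<in> Psi"
    and ls: "length_space (Pi UNIV X) (dist_psi \<psi> d)"
  shows "length_space (X k) (d k)"
  unfolding length_space_iff_lipschitz_paths
proof (intro conjI ballI allI impI)
  show "Metric_space (X k) (d k)"
    by (rule ms)
  fix u v and e :: real
  assume uv: "u \<in> X k" "v \<in> X k" and "0 < e"
  have nonneg: "0 \<le> d i p q" for i p q
    using Metric_space.nonneg[OF ms] .
  \<comment> \<open>A base point, whose coordinates other than \<open>k\<close> stay fixed in the copy of the factor.\<close>
  obtain w where w: "\<And>i. w i \<in> X i"
    using ne that[of "\<lambda>i. SOME x. x \<in> X i"] by (simp add: some_in_eq)
  define U V where "U = w(k := u)" and "V = w(k := v)"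
  have UV: "U \<in> Pi UNIV X" "V \<in> Pi UNIV X"
    using w uv by (auto simp: U_def V_def)
  have "d i (w i) (w i) = 0" for i
    using w Metric_space.mdist_zero[OF ms] by blast
  then have "(\<chi> i. d i (U i) (V i)) = axis k (d k u v)"
    by (simp add: vec_eq_iff axis_def U_def V_def)
  then have dist: "dist_psi \<psi> d U V = d k u v"
    using UV psi by (simp add: dist_psi_eq_psi_gauge[OF ms] psi_gauge_axis)
  obtain \<tau> where \<tau>: "lipschitz_path (Pi UNIV X) (dist_psi \<psi> d) (d k u v + e) U V \<tau>"
    using ls UV \<open>0 < e\<close> dist unfolding length_space_iff_lipschitz_paths by metis
  have "d k (\<tau> s k) (\<tau> t k) \<le> (d k u v + e) * (t - s)" if st: "0 \<le> s" "s \<le> t" "t \<le> 1" for s t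
  proof -
    have "\<tau> s \<in> Pi UNIV X" "\<tau> t \<in> Pi UNIV X"
      using \<tau> st by (auto simp: lipschitz_path_def)
    then have "d k (\<tau> s k) (\<tau> t k) \<le> dist_psi \<psi> d (\<tau> s) (\<tau> t)"
      using coord_le_psi_gauge[OF psi, of "\<chi> i. d i (\<tau> s i) (\<tau> t i)" k]
      by (simp add: dist_psi_eq_psi_gauge[OF ms] nonneg)
    also have "\<dots> \<le> (d k u v + e) * (t - s)"
      using \<tau> st by (simp add: lipschitz_path_def)
    finally show ?thesis .
  qed
  then have "lipschitz_path (X k) (d k) (d k u v + e) u v (\<lambda>s. \<tau> s k)"
    using \<tau> by (auto simp: lipschitz_path_def U_def V_def Pi_iff)
  then show "\<exists>\<tau>. lipschitz_path (X k) (d k) (d k u v + e) u v \<tau>"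
    by (rule exI[of _ "\<lambda>s. \<tau> s k"])
qed

theorem theorem6p5:
  fixes X :: "'n::finite \<Rightarrow> 'a set"
    and d :: "'n \<Rightarrow> 'a \<Rightarrow> 'a \<Rightarrow> real"
    and \<psi> :: "real ^ 'n \<Rightarrow> real"
  assumes "CARD('n) \<ge> 2"
    and "\<And>i. Metric_space (X i) (d i)"
    and "\<And>i. X i \<noteq> {}"
    and "\<psi> \<in> Psi"
  shows "(\<forall>i. length_space (X i) (d i)) \<longleftrightarrow> length_space (Pi UNIV X) (dist_psi \<psi> d)"
  using length_space_prod[of X d \<psi>] length_space_factor[of X d \<psi>] assms(2-4) by blast

end
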